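(* Let $Q\subseteq\mathbb{R}^n$ be closed and convex, let $d$ be a convex differentiable prox-function with Bregman divergence $V$, let $\delta>0$, and let $g:Q\to\mathbb{R}^n$ be relatively $\mu$-strongly monotone with $\mu>0$ and $\delta$-generalized smooth with some constant $L>0$ (both with respect to $V$). Let $z_*\in Q$ be an exact solution of the variational inequality $\max_{x\in Q}\langle g(x), z_*-x\rangle\leq 0$. Let $L_0>0$ and let $(z_k)_{k\ge 0}$, $(w_k)_{k\ge0}$, $(L_k)_{k\ge 0}$ be generated by the adaptive method described in the context. Then for every $k\geq 0$ $$V(z_*, z_{k+1}) \leq \prod_{i=1}^{k+1}\left(1+\frac{\mu}{L_{i}}\right)^{-1} V(z_*, z_0)+\frac{\delta}{L_{k+1}+\mu}+\sum_{j=1}^{k}\frac{\delta}{L_j+\mu}\prod_{i=j+1}^{k+1}\left(1+\frac{\mu}{L_i}\right)^{-1}.$$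
   Context: Setting. $Q\subseteq\mathbb{R}^n$ is a closed convex set and $g:Q\to\mathbb{R}^n$ is an operator. $d$ is a convex (in general not strongly convex) differentiable function on $Q$, called the prox-function, and the corresponding Bregman divergence is $$V(y,x):=d(y)-d(x)-\langle\nabla d(x),y-x\rangle .$$ A solution (weak solution) of the variational inequality is a point $z_*\in Q$ with $\langle g(x),z_*-x\rangle\leq 0$ for all $x\in Q$; such a solution is assumed to exist. Relative strong monotonicity: $g$ is relatively $\mu$-strongly monotone ($\mu>0$) if for all $x,y\in Q$ $$\mu V(y,x)+\mu V(x,y)\leq\langle g(y)-g(x),y-x\rangle .$$ $\delta$-generalized smoothness with constant $L$: for the fixed $\delta>0$ and all $x,y,z\in Q$ $$\langle g(y)-g(z),x-z\rangle\leq L V(x,z)+L V(z,y)+\delta .$$ Adaptive method. Input: $\delta>0$ (the same as in the smoothness condition), $L_0>0$, $\mu>0$, $d$, $V$. Set $z_0=\arg\min_{u\in Q} d(u)$. For each $k=0,1,2,\dots$ find the smallest integer $i_k\geq 0$ such that, with $L_{k+1}=2^{i_k-1}L_k$ and $$w_k=\arg\min_{y\in Q}\left\{\left\langle\tfrac{1}{L_{k+1}}g(z_k),y\right\rangle+V(y,z_k)\right\},$$ $$z_{k+1}=\arg\min_{z\in Q}\left\{\left\langle\tfrac{1}{L_{k+1}}g(w_k),z\right\rangle+V(z,z_k)+\tfrac{\mu}{L_{k+1}}V(z,w_k)\right\},$$ the inequality $$\langle g(z_k)-g(w_k),z_{k+1}-w_k\rangle\leq L_{k+1}\left(V(w_k,z_k)+V(z_{k+1},w_k)\right)+\delta$$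 holds. The values $L_{k+1},w_k,z_{k+1}$ for this $i_k$ are the ones used. Here $\arg\min$ denotes a minimizer; all minimizers in the method (including those for trial values of $i_k$) are assumed to exist. An empty sum equals $0$. *)

theory Defs
  imports "HOL-Analysis.Analysis"
begin

text \<open>Differentiability is taken within \<open>Q\<close>, so boundary points of \<open>Q\<close> are allowed. If \<open>Q\<close> has
  empty interior the gradient is not unique, but its inner products with \<open>y - x\<close> for
  \<open>x, y \<in> Q\<close> are, and only those enter the Bregman divergence on \<open>Q\<close>.\<close>

definition gradient_on :: "(real ^ 'n) set \<Rightarrow> (real ^ 'n \<Rightarrow> real) \<Rightarrow> (real ^ 'n \<Rightarrow> real ^ 'n) \<Rightarrow> bool"
  where "gradient_on Q d Dd \<longleftrightarrow>
    (\<forall>x\<in>Q. (d has_derivative (\<lambda>h. Dd x \<bullet> h)) (at x within Q))"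

definition bregman ::
    "(real ^ 'n \<Rightarrow> real) \<Rightarrow> (real ^ 'n \<Rightarrow> real ^ 'n) \<Rightarrow> real ^ 'n \<Rightarrow> real ^ 'n \<Rightarrow> real"
  where "bregman d Dd y x = d y - d x - Dd x \<bullet> (y - x)"

definition weak_VI_solution :: "(real ^ 'n) set \<Rightarrow> (real ^ 'n \<Rightarrow> real ^ 'n) \<Rightarrow> real ^ 'n \<Rightarrow> bool"
  where "weak_VI_solution Q g zs \<longleftrightarrow> zs \<in> Q \<and> (\<forall>x\<in>Q. g x \<bullet> (zs - x) \<le> 0)"

definition relatively_strongly_monotone_on ::
    "(real ^ 'n) set \<Rightarrow> (real ^ 'n \<Rightarrow> real ^ 'n \<Rightarrow> real) \<Rightarrow> real \<Rightarrow> (real ^ 'n \<Rightarrow> real ^ 'n) \<Rightarrow> bool"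
  where "relatively_strongly_monotone_on Q V \<mu> g \<longleftrightarrow>
    (\<forall>x\<in>Q. \<forall>y\<in>Q. \<mu> * V y x + \<mu> * V x y \<le> (g y - g x) \<bullet> (y - x))"

definition generalized_smooth_on ::
    "(real ^ 'n) set \<Rightarrow> (real ^ 'n \<Rightarrow> real ^ 'n \<Rightarrow> real) \<Rightarrow> real \<Rightarrow> real \<Rightarrow> (real ^ 'n \<Rightarrow> real ^ 'n) \<Rightarrow> bool"
  where "generalized_smooth_on Q V \<delta> L g \<longleftrightarrow>
    (\<forall>x\<in>Q. \<forall>y\<in>Q. \<forall>z\<in>Q. (g y - g z) \<bullet> (x - z) \<le> L * V x z + L * V z y + \<delta>)"

text \<open>One trial of the inner search: \<open>w\<close> and \<open>z'\<close> are the two minimizers computed from the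
  current point \<open>z\<close> with trial constant \<open>M\<close> (in the role of \<open>L\<^bsub>k+1\<^esub>\<close>).\<close>

definition trial_points ::
    "(real ^ 'n) set \<Rightarrow> (real ^ 'n \<Rightarrow> real ^ 'n \<Rightarrow> real) \<Rightarrow> real \<Rightarrow> (real ^ 'n \<Rightarrow> real ^ 'n) \<Rightarrow>
      real ^ 'n \<Rightarrow> real \<Rightarrow> real ^ 'n \<Rightarrow> real ^ 'n \<Rightarrow> bool"
  where "trial_points Q V \<mu> g z M w z' \<longleftrightarrow>
    is_arg_min (\<lambda>y. ((1 / M) *\<^sub>R g z) \<bullet> y + V y z) (\<lambda>y. y \<in> Q) w \<and>
    is_arg_min (\<lambda>u. ((1 / M) *\<^sub>R g w) \<bullet> u + V u z + \<mu> / M * V u w) (\<lambda>u. u \<in> Q) z'"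

definition trial_accepted ::
    "(real ^ 'n \<Rightarrow> real ^ 'n \<Rightarrow> real) \<Rightarrow> real \<Rightarrow> (real ^ 'n \<Rightarrow> real ^ 'n) \<Rightarrow>
      real ^ 'n \<Rightarrow> real \<Rightarrow> real ^ 'n \<Rightarrow> real ^ 'n \<Rightarrow> bool"
  where "trial_accepted V \<delta> g z M w z' \<longleftrightarrow>
    (g z - g w) \<bullet> (z' - w) \<le> M * (V w z + V z' w) + \<delta>"

text \<open>\<open>wt i\<close> and \<open>zt i\<close> are the minimizers chosen in trial \<open>i\<close>; the choice is arbitrary when
  minimizers are not unique. Trial \<open>i\<close> takes place only if all earlier trials were rejected, and
  minimizers are required only for the trials that take place. That some trial is accepted (so that
  the \<open>LEAST\<close> is attained) is not part of the definition; it follows from generalized smoothness.\<close>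

definition adaptive_step ::
    "(real ^ 'n) set \<Rightarrow> (real ^ 'n \<Rightarrow> real ^ 'n \<Rightarrow> real) \<Rightarrow> real \<Rightarrow> real \<Rightarrow> (real ^ 'n \<Rightarrow> real ^ 'n) \<Rightarrow>
      real ^ 'n \<Rightarrow> real \<Rightarrow> real ^ 'n \<Rightarrow> real ^ 'n \<Rightarrow> real \<Rightarrow> bool"
  where "adaptive_step Q V \<delta> \<mu> g z M w z' M' \<longleftrightarrow>
    (\<exists>wt zt :: nat \<Rightarrow> real ^ 'n.
      let Mt = (\<lambda>i::nat. 2 powi (int i - 1) * M);
          accepted = (\<lambda>i. trial_accepted V \<delta> g z (Mt i) (wt i) (zt i));
          ik = (LEAST i. accepted i)
      in (\<forall>i. (\<forall>j<i. \<not> accepted j) \<longrightarrow> trial_points Q V \<mu> g z (Mt i) (wt i) (zt i)) \<and>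
         M' = Mt ik \<and> w = wt ik \<and> z' = zt ik)"

definition adaptive_method ::
    "(real ^ 'n) set \<Rightarrow> (real ^ 'n \<Rightarrow> real) \<Rightarrow> (real ^ 'n \<Rightarrow> real ^ 'n \<Rightarrow> real) \<Rightarrow> real \<Rightarrow> real \<Rightarrow> real \<Rightarrow>
      (real ^ 'n \<Rightarrow> real ^ 'n) \<Rightarrow> (nat \<Rightarrow> real ^ 'n) \<Rightarrow> (nat \<Rightarrow> real ^ 'n) \<Rightarrow> (nat \<Rightarrow> real) \<Rightarrow> bool"
  where "adaptive_method Q d V \<delta> L\<^sub>0 \<mu> g z w L \<longleftrightarrow>
    is_arg_min d (\<lambda>u. u \<in> Q) (z 0) \<and> L 0 = L\<^sub>0 \<and>
    (\<forall>k. adaptive_step Q V \<delta> \<mu> g (z k) (L k) (w k) (z (Suc k)) (L (Suc k)))"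

end

theory Submission
  imports Defs
begin

text \<open>Write \<open>V\<close> for the Bregman divergence and let \<open>(z, M) \<mapsto> (w, z', M')\<close> be one step of the method.
  The whole bound is the iteration of the one-step contraction
  \<open>(1 + \<mu> / M') V(zs, z') \<le> V(zs, z) + \<delta> / M'\<close>.

  To obtain it, test the first-order optimality condition of \<open>w\<close> against \<open>z'\<close> and that of \<open>z'\<close>
  against \<open>zs\<close>, and rewrite all gradient differences as divergences by the three-point identity
  (\<open>bregman_prox_inequality\<close>). Adding the two, the terms \<open>V(z', z)\<close> cancel, the acceptance
  criterion absorbs \<open>(g z - g w) \<bullet> (z' - w)\<close> at the cost of \<open>\<delta> / M'\<close>, and what remains of the
  operator is \<open>g w \<bullet> (w - zs)\<close>. The regularizing term \<open>\<mu> / M' V(u, w)\<close> in the subproblem for \<open>z'\<close>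
  leaves \<open>\<mu> / M' V(zs, w)\<close> on the right, which is compensated exactly if
  \<open>\<mu> V(zs, w) \<le> g w \<bullet> (w - zs)\<close>.

  For a strong solution (\<open>g zs \<bullet> (w - zs) \<ge> 0\<close>) this last inequality would be immediate from strong
  monotonicity, but \<open>zs\<close> is only a weak solution and \<open>g\<close> need not be continuous, so \<open>zs\<close> may fail to
  be a strong one. Lemma \<open>weak_VI_solution_strong_bound\<close> gets around this by comparing \<open>w\<close> with
  points on the segment towards \<open>zs\<close>, where the weak inequality is available, and passing to the
  limit using only the continuity of \<open>d\<close>.

  Finally, the inner search terminates, because generalized smoothness makes every trial with
  constant at least \<open>Lg\<close> acceptable; so the accepted trial really satisfies its criterion.\<close>

section \<open>First-order conditions on a convex set\<close>

lemma segment_in_convex: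
  fixes x y :: "'a::real_vector"
  assumes "convex Q" "x \<in> Q" "y \<in> Q" "0 \<le> t" "t \<le> 1"
  shows "x + t *\<^sub>R (y - x) \<in> Q"
proof -
  have "(1 - t) *\<^sub>R x + t *\<^sub>R y \<in> Q" using assms by (intro convexD) auto
  then show ?thesis by (simp add: algebra_simps)
qed

lemma directional_derivative_within_convex:
  fixes f :: "'a::real_normed_vector \<Rightarrow> real"
  assumes der: "(f has_derivative f') (at x within Q)"
    and Q: "convex Q" "x \<in> Q" "y \<in> Q"
  shows "((\<lambda>t. (f (x + t *\<^sub>R (y - x)) - f x) / t) \<longlongrightarrow> f' (y - x)) (at 0 within {0..1::real})"
proof -
  let ?\<phi> = "\<lambda>t::real. x + t *\<^sub>R (y - x)"
  have sub: "?\<phi> ` {0..1} \<subseteq> Q" using segment_in_convex[OF Q] by auto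
  have 1: "(?\<phi> has_derivative (\<lambda>t. t *\<^sub>R (y - x))) (at 0 within {0..1})"
    by (auto intro!: derivative_eq_intros)
  have 2: "(f has_derivative f') (at (?\<phi> 0) within ?\<phi> ` {0..1})"
    using has_derivative_subset[OF der sub] by simp
  have "((\<lambda>t. f (?\<phi> t)) has_derivative (\<lambda>t. f' (t *\<^sub>R (y - x)))) (at 0 within {0..1})"
    by (rule has_derivative_in_compose[OF 1 2])
  moreover have "(\<lambda>t. f' (t *\<^sub>R (y - x))) = (*) (f' (y - x))"
    using linear_scale[OF has_derivative_linear[OF der]] by (auto simp: mult.commute)
  ultimately have "((\<lambda>t. f (?\<phi> t)) has_field_derivative f' (y - x)) (at 0 within {0..1})"
    by (simp add: has_field_derivative_def)
  then show ?thesis by (simp add: has_field_derivative_iff)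
qed

lemma nontrivial_at_0_unit_interval: "at (0::real) within {0..1} \<noteq> bot"
  by (simp add: trivial_limit_within)

lemma is_arg_min_first_order:
  fixes f :: "'a::real_normed_vector \<Rightarrow> real"
  assumes min: "is_arg_min f (\<lambda>x. x \<in> Q) x"
    and der: "(f has_derivative f') (at x within Q)"
    and Q: "convex Q" "y \<in> Q"
  shows "0 \<le> f' (y - x)"
proof (rule tendsto_lowerbound[OF directional_derivative_within_convex[OF der \<open>convex Q\<close> _ \<open>y \<in> Q\<close>]])
  have x: "x \<in> Q" and le: "\<And>u. u \<in> Q \<Longrightarrow> f x \<le> f u"
    using min by (auto simp: is_arg_min_linorder)
  show "x \<in> Q" by (fact x)
  show "\<forall>\<^sub>F t in at 0 within {0..1}. 0 \<le> (f (x + t *\<^sub>R (y - x)) - f x) / t"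
    unfolding eventually_at_filter
    using le[OF segment_in_convex[OF Q(1) x Q(2)]] by (auto intro!: always_eventually)
qed (rule nontrivial_at_0_unit_interval)

section \<open>Bregman divergences\<close>

lemma bregman_nonneg:
  assumes Q: "convex Q" and d: "convex_on Q d" "gradient_on Q d Dd"
    and xy: "x \<in> Q" "y \<in> Q"
  shows "0 \<le> bregman d Dd y x"
proof -
  have der: "(d has_derivative (\<lambda>h. Dd x \<bullet> h)) (at x within Q)"
    using d xy by (auto simp: gradient_on_def)
  have "(d (x + t *\<^sub>R (y - x)) - d x) / t \<le> d y - d x" if t: "0 < t" "t \<le> 1" for t :: real
  proof -
    have "d ((1 - t) *\<^sub>R x + t *\<^sub>R y) \<le> (1 - t) * d x + t * d y"
      using convex_onD[OF d(1), of t x y] xy t by simp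
    then have "d (x + t *\<^sub>R (y - x)) - d x \<le> (d y - d x) * t"
      by (simp add: algebra_simps)
    then show ?thesis using t by (simp add: pos_divide_le_eq)
  qed
  then have "\<forall>\<^sub>F t in at 0 within {0..1}. (d (x + t *\<^sub>R (y - x)) - d x) / t \<le> d y - d x"
    unfolding eventually_at_filter by (auto intro!: always_eventually)
  then have "Dd x \<bullet> (y - x) \<le> d y - d x"
    using tendsto_upperbound[OF directional_derivative_within_convex[OF der Q xy]]
      nontrivial_at_0_unit_interval by blast
  then show ?thesis by (simp add: bregman_def)
qed

lemma bregman_three_point:
  "(Dd x - Dd z) \<bullet> (y - x) = bregman d Dd y z - bregman d Dd y x - bregman d Dd x z"
  by (simp add: bregman_def inner_diff_left inner_diff_right)

lemma has_derivative_bregman: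
  assumes "gradient_on Q d Dd" "x \<in> Q"
  shows "((\<lambda>y. bregman d Dd y z) has_derivative (\<lambda>h. (Dd x - Dd z) \<bullet> h)) (at x within Q)"
proof -
  have "(d has_derivative (\<lambda>h. Dd x \<bullet> h)) (at x within Q)"
    using assms by (auto simp: gradient_on_def)
  then show ?thesis
    unfolding bregman_def
    by (auto intro!: derivative_eq_intros simp: inner_diff_left)
qed

text \<open>Optimality of a proximal step with two anchors \<open>z\<close> and \<open>v\<close>; both subproblems of the method are
  of this form, the one for \<open>w\<close> with weight \<open>c = 0\<close>.\<close>

lemma bregman_prox_inequality:
  assumes Q: "convex Q" and d: "gradient_on Q d Dd" and u: "u \<in> Q"
    and min: "is_arg_min (\<lambda>y. a \<bullet> y + bregman d Dd y z + c * bregman d Dd y v) (\<lambda>y. y \<in> Q) x"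
  shows "a \<bullet> (x - u) \<le> bregman d Dd u z - bregman d Dd u x - bregman d Dd x z
    + c * (bregman d Dd u v - bregman d Dd u x - bregman d Dd x v)"
proof -
  have x: "x \<in> Q" using min by (simp add: is_arg_min_def)
  have "((\<lambda>y. a \<bullet> y + bregman d Dd y z + c * bregman d Dd y v) has_derivative
      (\<lambda>h. a \<bullet> h + (Dd x - Dd z) \<bullet> h + c * ((Dd x - Dd v) \<bullet> h))) (at x within Q)"
    by (intro derivative_intros has_derivative_bregman[OF d x])
  from is_arg_min_first_order[OF min this Q u]
  have "0 \<le> a \<bullet> (u - x) + (Dd x - Dd z) \<bullet> (u - x) + c * ((Dd x - Dd v) \<bullet> (u - x))" .
  then show ?thesis
    unfolding bregman_three_point[of Dd x _ u d] by (simp add: inner_diff_right)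
qed

section \<open>Weak solutions of strongly monotone variational inequalities\<close>

text \<open>Along \<open>x\<^sub>t = zs + t (w - zs)\<close> the weak inequality says \<open>g x\<^sub>t \<bullet> (w - zs) \<ge> 0\<close>, because
  \<open>x\<^sub>t - zs\<close> is a positive multiple of \<open>w - zs\<close>. So is \<open>w - x\<^sub>t\<close>, and strong monotonicity between
  \<open>w\<close> and \<open>x\<^sub>t\<close> therefore yields \<open>(1 - t) g w \<bullet> (w - zs) \<ge> \<mu> V(x\<^sub>t, w)\<close>. Only \<open>V\<close> still depends on
  \<open>x\<^sub>t\<close>, so letting \<open>t \<rightarrow> 0\<close> needs no continuity of \<open>g\<close>.\<close>

lemma weak_VI_solution_strong_bound:
  assumes Q: "convex Q" and d: "convex_on Q d" "gradient_on Q d Dd" and "\<mu> > 0"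
    and mono: "relatively_strongly_monotone_on Q (bregman d Dd) \<mu> g"
    and sol: "weak_VI_solution Q g zs" and w: "w \<in> Q"
  shows "\<mu> * bregman d Dd zs w \<le> g w \<bullet> (w - zs)"
proof -
  define x where "x t = zs + t *\<^sub>R (w - zs)" for t :: real
  have zs: "zs \<in> Q" using sol by (simp add: weak_VI_solution_def)
  have xQ: "x t \<in> Q" if "0 \<le> t" "t \<le> 1" for t
    unfolding x_def by (rule segment_in_convex[OF Q zs w that])
  have ineq: "\<mu> * bregman d Dd (x t) w \<le> (1 - t) * (g w \<bullet> (w - zs))"
    if t: "0 < t" "t \<le> 1" for t
  proof -
    have xt: "x t \<in> Q" using xQ t by simp
    have "zs - x t = - (t *\<^sub>R (w - zs))" by (simp add: x_def)
    with sol xt have "- (t * (g (x t) \<bullet> (w - zs))) \<le> 0"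
      unfolding weak_VI_solution_def by (metis inner_minus_right inner_scaleR_right)
    then have weak: "0 \<le> g (x t) \<bullet> (w - zs)" using t by (simp add: zero_le_mult_iff)
    have "w - x t = (1 - t) *\<^sub>R (w - zs)" by (simp add: x_def algebra_simps)
    with mono xt w have "\<mu> * bregman d Dd w (x t) + \<mu> * bregman d Dd (x t) w
        \<le> (1 - t) * ((g w - g (x t)) \<bullet> (w - zs))"
      unfolding relatively_strongly_monotone_on_def by (metis inner_scaleR_right)
    also have "\<dots> \<le> (1 - t) * (g w \<bullet> (w - zs))"
      using weak t by (intro mult_left_mono) (auto simp: inner_diff_left)
    finally show ?thesis
      using mult_nonneg_nonneg[of \<mu>, OF _ bregman_nonneg[OF Q d xt w]] \<open>\<mu> > 0\<close> by linarith
  qed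
  have "continuous_on Q (\<lambda>y. bregman d Dd y w)"
    using has_derivative_continuous[OF has_derivative_bregman[OF d(2)]]
    by (auto simp: continuous_on_eq_continuous_within)
  moreover have "continuous_on {0..1} x" unfolding x_def by (intro continuous_intros)
  ultimately have "continuous_on {0..1} (\<lambda>t. bregman d Dd (x t) w)"
    using xQ by (intro continuous_on_compose2[of Q "\<lambda>y. bregman d Dd y w" "{0..1}" x]) auto
  then have "((\<lambda>t. bregman d Dd (x t) w) \<longlongrightarrow> bregman d Dd (x 0) w) (at 0 within {0..1})"
    by (simp add: continuous_on_def)
  then have L: "((\<lambda>t. \<mu> * bregman d Dd (x t) w) \<longlongrightarrow> \<mu> * bregman d Dd zs w) (at 0 within {0..1})"
    by (intro tendsto_mult_left) (simp add: x_def)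
  have R: "((\<lambda>t. (1 - t) * (g w \<bullet> (w - zs))) \<longlongrightarrow> (1 - 0) * (g w \<bullet> (w - zs))) (at 0 within {0..1})"
    by (intro tendsto_intros)
  have "\<forall>\<^sub>F t in at 0 within {0..1}. \<mu> * bregman d Dd (x t) w \<le> (1 - t) * (g w \<bullet> (w - zs))"
    unfolding eventually_at_filter using ineq by (auto intro!: always_eventually)
  from tendsto_le[OF nontrivial_at_0_unit_interval R L this] show ?thesis by simp
qed

section \<open>One step of the adaptive method\<close>

lemma trial_points_mem:
  "trial_points Q V \<mu> g z M w z' \<Longrightarrow> w \<in> Q \<and> z' \<in> Q"
  by (simp add: trial_points_def is_arg_min_def)

text \<open>The Bregman divergence is nonnegative, so enlarging the trial constant beyond \<open>Lg\<close> preserves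
  the inequality of generalized smoothness, and that is the acceptance criterion.\<close>

lemma generalized_smooth_imp_trial_accepted:
  assumes Q: "convex Q" and d: "convex_on Q d" "gradient_on Q d Dd"
    and smooth: "generalized_smooth_on Q (bregman d Dd) \<delta> Lg g"
    and mem: "z \<in> Q" "w \<in> Q" "z' \<in> Q" and M: "Lg \<le> M"
  shows "trial_accepted (bregman d Dd) \<delta> g z M w z'"
proof -
  have "(g z - g w) \<bullet> (z' - w) \<le> Lg * bregman d Dd z' w + Lg * bregman d Dd w z + \<delta>"
    using smooth mem unfolding generalized_smooth_on_def by blast
  also have "\<dots> = Lg * (bregman d Dd w z + bregman d Dd z' w) + \<delta>"
    by (simp add: algebra_simps)
  also have "\<dots> \<le> M * (bregman d Dd w z + bregman d Dd z' w) + \<delta>"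
    using M bregman_nonneg[OF Q d] mem by (simp add: mult_right_mono)
  finally show ?thesis by (simp add: trial_accepted_def)
qed

lemma adaptive_step_result:
  assumes Q: "convex Q" and d: "convex_on Q d" "gradient_on Q d Dd"
    and smooth: "generalized_smooth_on Q (bregman d Dd) \<delta> Lg g"
    and step: "adaptive_step Q (bregman d Dd) \<delta> \<mu> g z M w z' M'"
    and z: "z \<in> Q" and M: "M > 0"
  shows "M' > 0" "trial_points Q (bregman d Dd) \<mu> g z M' w z'"
    "trial_accepted (bregman d Dd) \<delta> g z M' w z'"
proof -
  define Mt where "Mt i = 2 powi (int i - 1) * M" for i :: nat
  obtain wt zt where *:
    "\<And>i. \<forall>j<i. \<not> trial_accepted (bregman d Dd) \<delta> g z (Mt j) (wt j) (zt j) \<Longrightarrow>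
      trial_points Q (bregman d Dd) \<mu> g z (Mt i) (wt i) (zt i)"
    "M' = Mt (LEAST i. trial_accepted (bregman d Dd) \<delta> g z (Mt i) (wt i) (zt i))"
    "w = wt (LEAST i. trial_accepted (bregman d Dd) \<delta> g z (Mt i) (wt i) (zt i))"
    "z' = zt (LEAST i. trial_accepted (bregman d Dd) \<delta> g z (Mt i) (wt i) (zt i))"
    using step unfolding adaptive_step_def Let_def Mt_def by blast
  define acc where "acc i = trial_accepted (bregman d Dd) \<delta> g z (Mt i) (wt i) (zt i)" for i
  note * = *[folded acc_def]
  have ex: "\<exists>i. acc i"
  proof (rule ccontr)
    assume none: "\<nexists>i. acc i"
    obtain n where n: "2 * Lg / M < 2 ^ n" using real_arch_pow[of 2 "2 * Lg / M"] by auto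
    have "Mt n = 2 ^ n * M / 2" by (simp add: Mt_def power_int_diff)
    with n M have "Lg \<le> Mt n" by (simp add: field_simps)
    \<comment> \<open>If every trial is rejected, then every trial takes place, so its points lie in \<open>Q\<close>.\<close>
    moreover have "wt n \<in> Q \<and> zt n \<in> Q" using *(1) none trial_points_mem by blast
    ultimately have "acc n"
      unfolding acc_def using generalized_smooth_imp_trial_accepted[OF Q d smooth z] by blast
    with none show False by blast
  qed
  show "M' > 0" using M by (simp add: *(2) Mt_def)
  show "trial_points Q (bregman d Dd) \<mu> g z M' w z'"
    unfolding *(2-4) by (rule *(1)) (auto dest: not_less_Least)
  show "trial_accepted (bregman d Dd) \<delta> g z M' w z'"
    using LeastI_ex[OF ex] unfolding acc_def[of "Least acc"] *(2-4) .
qed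

lemma accepted_trial_contraction:
  assumes Q: "convex Q" and d: "convex_on Q d" "gradient_on Q d Dd"
    and \<mu>: "\<mu> > 0" and M: "M > 0"
    and mono: "relatively_strongly_monotone_on Q (bregman d Dd) \<mu> g"
    and sol: "weak_VI_solution Q g zs"
    and trial: "trial_points Q (bregman d Dd) \<mu> g z M w z'"
    and acc: "trial_accepted (bregman d Dd) \<delta> g z M w z'"
  shows "bregman d Dd zs z' \<le> inverse (1 + \<mu> / M) * bregman d Dd zs z + \<delta> / (M + \<mu>)"
proof -
  let ?V = "bregman d Dd"
  have zs: "zs \<in> Q" using sol by (simp add: weak_VI_solution_def)
  have w: "w \<in> Q" and z': "z' \<in> Q" using trial_points_mem[OF trial] by auto
  have "is_arg_min (\<lambda>y. ((1 / M) *\<^sub>R g z) \<bullet> y + ?V y z + 0 * ?V y z) (\<lambda>y. y \<in> Q) w"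
    using trial by (simp add: trial_points_def)
  from bregman_prox_inequality[OF Q d(2) z' this]
  have "(g z \<bullet> (w - z')) / M \<le> ?V z' z - ?V z' w - ?V w z" by simp
  then have 1: "g z \<bullet> (w - z') \<le> M * (?V z' z - ?V z' w - ?V w z)"
    using M by (simp add: pos_divide_le_eq mult.commute)
  have "is_arg_min (\<lambda>y. ((1 / M) *\<^sub>R g w) \<bullet> y + ?V y z + \<mu> / M * ?V y w) (\<lambda>y. y \<in> Q) z'"
    using trial by (simp add: trial_points_def)
  from bregman_prox_inequality[OF Q d(2) zs this]
  have "(g w \<bullet> (z' - zs)) / M
      \<le> ?V zs z - ?V zs z' - ?V z' z + \<mu> / M * (?V zs w - ?V zs z' - ?V z' w)" by simp
  then have 2: "g w \<bullet> (z' - zs)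
      \<le> M * (?V zs z - ?V zs z' - ?V z' z) + \<mu> * (?V zs w - ?V zs z' - ?V z' w)"
    using M by (simp add: field_simps)
  have 3: "(g z - g w) \<bullet> (z' - w) \<le> M * (?V w z + ?V z' w) + \<delta>"
    using acc by (simp add: trial_accepted_def)
  have 4: "\<mu> * ?V zs w \<le> g w \<bullet> (w - zs)"
    by (rule weak_VI_solution_strong_bound[OF Q d \<mu> mono sol w])
  have 5: "g w \<bullet> (w - zs) = g z \<bullet> (w - z') + g w \<bullet> (z' - zs) + (g z - g w) \<bullet> (z' - w)"
    by (simp add: inner_diff_left inner_diff_right)
  have 6: "0 \<le> \<mu> * ?V z' w" using \<mu> bregman_nonneg[OF Q d w z'] by simp
  have "(M + \<mu>) * ?V zs z' \<le> M * ?V zs z + \<delta>"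
    using 1 2 3 4 5 6 by (simp add: algebra_simps)
  then have "?V zs z' \<le> (M * ?V zs z + \<delta>) / (M + \<mu>)"
    using M \<mu> by (simp add: pos_le_divide_eq mult.commute)
  also have "\<dots> = inverse (1 + \<mu> / M) * ?V zs z + \<delta> / (M + \<mu>)"
  proof -
    have "inverse (1 + \<mu> / M) = M / (M + \<mu>)" using M \<mu> by (simp add: field_simps)
    then show ?thesis by (simp add: add_divide_distrib)
  qed
  finally show ?thesis .
qed

section \<open>Iterating the contraction\<close>

lemma linear_recursion_bound:
  fixes v q e :: "nat \<Rightarrow> real"
  assumes step: "\<And>k. v (Suc k) \<le> q (Suc k) * v k + e (Suc k)" and q: "\<And>k. q (Suc k) \<ge> 0"
  shows "v (k + 1) \<le> (\<Prod>i = 1..k + 1. q i) * v 0 + e (k + 1)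
    + (\<Sum>j = 1..k. e j * (\<Prod>i = j + 1..k + 1. q i))"
proof (induction k)
  case 0
  show ?case using step[of 0] by simp
next
  case (Suc k)
  let ?S = "\<lambda>k. \<Sum>j = 1..k. e j * (\<Prod>i = j + 1..k + 1. q i)"
  have "?S (Suc k) = (\<Sum>j = 1..k. e j * (\<Prod>i = j + 1..k + 2. q i)) + e (k + 1) * q (k + 2)"
    by simp
  also have "(\<Sum>j = 1..k. e j * (\<Prod>i = j + 1..k + 2. q i)) = q (k + 2) * ?S k"
    unfolding sum_distrib_left by (rule sum.cong) (auto simp: mult_ac)
  finally have S: "?S (Suc k) = q (k + 2) * ?S k + e (k + 1) * q (k + 2)" .
  have "v (k + 2) \<le> q (k + 2) * v (k + 1) + e (k + 2)" using step[of "k + 1"] by simp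
  also have "\<dots> \<le> q (k + 2) * ((\<Prod>i = 1..k + 1. q i) * v 0 + e (k + 1) + ?S k) + e (k + 2)"
    using mult_left_mono[OF Suc.IH q[of "k + 1"]] by simp
  also have "\<dots> = (\<Prod>i = 1..Suc k + 1. q i) * v 0 + e (Suc k + 1) + ?S (Suc k)"
    unfolding S by (simp add: algebra_simps)
  finally show ?case by simp
qed

theorem mainTheorem2:
  fixes Q :: "(real ^ 'n) set"
    and d :: "real ^ 'n \<Rightarrow> real"
    and Dd :: "real ^ 'n \<Rightarrow> real ^ 'n"
    and g :: "real ^ 'n \<Rightarrow> real ^ 'n"
    and \<delta> \<mu> Lg L\<^sub>0 :: real
    and zs :: "real ^ 'n"
    and z w :: "nat \<Rightarrow> real ^ 'n"
    and L :: "nat \<Rightarrow> real"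
    and k :: nat
  assumes "closed Q" and "convex Q"
    and "convex_on Q d" and "gradient_on Q d Dd"
    and "\<delta> > 0" and "\<mu> > 0" and "Lg > 0" and "L\<^sub>0 > 0"
    and "relatively_strongly_monotone_on Q (bregman d Dd) \<mu> g"
    and "generalized_smooth_on Q (bregman d Dd) \<delta> Lg g"
    and "weak_VI_solution Q g zs"
    and "adaptive_method Q d (bregman d Dd) \<delta> L\<^sub>0 \<mu> g z w L"
  shows "bregman d Dd zs (z (k + 1))
    \<le> (\<Prod>i = 1..k + 1. inverse (1 + \<mu> / L i)) * bregman d Dd zs (z 0)
      + \<delta> / (L (k + 1) + \<mu>)
      + (\<Sum>j = 1..k. \<delta> / (L j + \<mu>) * (\<Prod>i = j + 1..k + 1. inverse (1 + \<mu> / L i)))"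
proof -
  note Q = \<open>convex Q\<close> and d = \<open>convex_on Q d\<close> \<open>gradient_on Q d Dd\<close> and \<mu> = \<open>\<mu> > 0\<close>
    and mono = \<open>relatively_strongly_monotone_on Q (bregman d Dd) \<mu> g\<close>
    and smooth = \<open>generalized_smooth_on Q (bregman d Dd) \<delta> Lg g\<close>
    and sol = \<open>weak_VI_solution Q g zs\<close>
    and run = \<open>adaptive_method Q d (bregman d Dd) \<delta> L\<^sub>0 \<mu> g z w L\<close>
  have step: "adaptive_step Q (bregman d Dd) \<delta> \<mu> g (z n) (L n) (w n) (z (Suc n)) (L (Suc n))" for n
    using run by (simp add: adaptive_method_def)
  note result = adaptive_step_result[OF Q d smooth step]
  have inv: "z n \<in> Q \<and> L n > 0" for n
  proof (induction n)
    case 0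
    show ?case using run \<open>L\<^sub>0 > 0\<close> by (simp add: adaptive_method_def is_arg_min_def)
  next
    case (Suc n)
    then show ?case using result[of n] trial_points_mem by blast
  qed
  show ?thesis
  proof (rule linear_recursion_bound[where v = "\<lambda>n. bregman d Dd zs (z n)"
        and q = "\<lambda>n. inverse (1 + \<mu> / L n)" and e = "\<lambda>n. \<delta> / (L n + \<mu>)"])
    fix n
    show "bregman d Dd zs (z (Suc n))
        \<le> inverse (1 + \<mu> / L (Suc n)) * bregman d Dd zs (z n) + \<delta> / (L (Suc n) + \<mu>)"
      using accepted_trial_contraction[OF Q d \<mu> _ mono sol] result[of n] inv[of n] by blast
    show "0 \<le> inverse (1 + \<mu> / L (Suc n))"
      using inv[of "Suc n"] \<mu> by simp
  qed
qed

end
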